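(* Let $m\ge1$ and let $B=(b_0,b_1,\dots,b_{N-1})$ be a singleton board fitting inside $\Delta_{N,m}$ (so $b_j\le jm$ for all $0\le j\le N-1$). Then for every integer $0\le k<N$, $$r_{k,m}(B)=\sum_{i=0}^k(-1)^i\,m^{k-i}\,S(N-i,N-k)\,e_i\bigl(-b_0,\,m-b_1,\,\dots,\,(N-1)m-b_{N-1}\bigr).$$
   Context: Fix an integer $m\ge 1$. A Ferrers board $B=(b_0,\dots,b_{N-1})$ with $0\le b_0\le b_1\le\dots\le b_{N-1}$ consists of bottom-justified columns of these heights, left to right (some initial heights may be zero). Level $p$ ($p\ge1$) consists of rows $(p-1)m+1,\dots,pm$, counted from the bottom. An $m$-level rook placement of $k$ rooks on $B$ is a set of $k$ cells of $B$, no two in the same column or the same level; $r_{k,m}(B)$ is the number of these. A column terminates in level $p$ if $p$ is the largest level it meets; $B$ is a singleton board if it is a Ferrers board and for each $p$ at most one column terminating in level $p$ has height not divisible by $m$. $\Delta_{N,m}$ is the Ferrers board $(0,m,2m,\dots,(N-1)m)$; $B$ fits inside $\Delta_{N,m}$ if, with lower right cells aligned, $B\subseteq\Delta_{N,m}$. $S(n,d)$ is the Stirling number of the second kind (number of partitions of an $n$-set into $d$ blocks), and $e_d(x_1,\dots,x_n)$ is the elementary symmetric polynomial of degree $d$. *)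

theory Defs
  imports "HOL-Combinatorics.Stirling"
begin

text \<open>A board is the list of its column heights, left to right. A cell is a pair (column, row),
  with columns counted from 0 on the left and rows counted from 1 at the bottom.\<close>

definition ferrers_board :: "nat list \<Rightarrow> bool" where
  "ferrers_board B \<longleftrightarrow> sorted B"

definition board_cells :: "nat list \<Rightarrow> (nat \<times> nat) set" where
  "board_cells B = {(j, r). j < length B \<and> 1 \<le> r \<and> r \<le> B ! j}"

definition level_rows :: "nat \<Rightarrow> nat \<Rightarrow> nat set" where
  "level_rows m p = {(p - 1) * m + 1 .. p * m}"

definition same_level :: "nat \<Rightarrow> nat \<Rightarrow> nat \<Rightarrow> bool" where
  "same_level m r s \<longleftrightarrow> (\<exists>p\<ge>1. r \<in> level_rows m p \<and> s \<in> level_rows m p)"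

definition level_rook_placements :: "nat \<Rightarrow> nat list \<Rightarrow> nat \<Rightarrow> (nat \<times> nat) set set" where
  "level_rook_placements m B k =
     {P. P \<subseteq> board_cells B \<and> finite P \<and> card P = k \<and>
         (\<forall>c\<in>P. \<forall>d\<in>P. c \<noteq> d \<longrightarrow> fst c \<noteq> fst d \<and> \<not> same_level m (snd c) (snd d))}"

definition level_rook_number :: "nat \<Rightarrow> nat \<Rightarrow> nat list \<Rightarrow> nat" where
  "level_rook_number k m B = card (level_rook_placements m B k)"

definition meets_level :: "nat \<Rightarrow> nat \<Rightarrow> nat \<Rightarrow> bool" where
  "meets_level m h p \<longleftrightarrow> p \<ge> 1 \<and> {1..h} \<inter> level_rows m p \<noteq> {}"

text \<open>Here h is the height of the column; an empty column terminates in no level.\<close>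

definition terminates_in_level :: "nat \<Rightarrow> nat \<Rightarrow> nat \<Rightarrow> bool" where
  "terminates_in_level m h p \<longleftrightarrow> meets_level m h p \<and> (\<forall>q. meets_level m h q \<longrightarrow> q \<le> p)"

definition singleton_board :: "nat \<Rightarrow> nat list \<Rightarrow> bool" where
  "singleton_board m B \<longleftrightarrow> ferrers_board B \<and>
     (\<forall>p\<ge>1. card {j. j < length B \<and> terminates_in_level m (B ! j) p \<and> \<not> m dvd B ! j} \<le> 1)"

definition Delta_board :: "nat \<Rightarrow> nat \<Rightarrow> nat list" where
  "Delta_board N m = map (\<lambda>j. j * m) [0..<N]"

text \<open>Alignment of the lower right cells: columns are renumbered from 0 on the right.\<close>

definition right_aligned_cells :: "nat list \<Rightarrow> (nat \<times> nat) set" where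
  "right_aligned_cells B = (\<lambda>(j, r). (length B - 1 - j, r)) ` board_cells B"

definition fits_inside :: "nat list \<Rightarrow> nat list \<Rightarrow> bool" where
  "fits_inside B D \<longleftrightarrow> right_aligned_cells B \<subseteq> right_aligned_cells D"

definition elem_sym :: "nat \<Rightarrow> 'a::comm_semiring_1 list \<Rightarrow> 'a" where
  "elem_sym d xs = (\<Sum>S | S \<subseteq> {..<length xs} \<and> card S = d. \<Prod>j\<in>S. xs ! j)"

end

theory Submission
  imports Defs
begin

text \<open>Append a column of height \<open>b\<close> at the right end of a board. In a singleton board every level
  met by an earlier column lies entirely inside the last one: otherwise both columns would terminate
  in the same level with heights not divisible by \<open>m\<close>. Hence \<open>k\<close> rooks in the earlier
  columns block exactly \<open>k m\<close> cells of the last column, and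
  \<open>r\<^sub>k\<^sub>+\<^sub>1(B, b) = r\<^sub>k\<^sub>+\<^sub>1(B) + (b - k m) r\<^sub>k(B)\<close>. The recurrences of the Stirling numbers and of the
  elementary symmetric polynomials show that the right-hand side obeys the same recurrence.\<close>

section \<open>Elementary symmetric polynomials and Stirling numbers\<close>

lemma elem_sym_0 [simp]: "elem_sym 0 xs = 1"
proof -
  have "{S. S \<subseteq> {..<length xs} \<and> card S = 0} = {{}}"
    by (auto dest: finite_subset)
  then show ?thesis by (simp add: elem_sym_def)
qed

lemma elem_sym_eq_0:
  assumes "length xs < d"
  shows "elem_sym d xs = 0"
proof -
  have "{S. S \<subseteq> {..<length xs} \<and> card S = d} = {}"
    using assms card_mono[OF finite_lessThan] by (auto simp: not_le[symmetric])
  then show ?thesis unfolding elem_sym_def by (metis sum.empty)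
qed

text \<open>The index sets of size \<open>Suc d\<close> are split by whether they contain the new
  index \<open>length xs\<close>; removing it leaves an arbitrary index set of size \<open>d\<close>
  for \<open>xs\<close>.\<close>

lemma elem_sym_snoc:
  "elem_sym (Suc d) (xs @ [x]) = elem_sym (Suc d) xs + x * elem_sym d xs"
proof -
  let ?n = "length xs"
  let ?A = "{S. S \<subseteq> {..<?n} \<and> card S = Suc d}"
  let ?C = "{S. S \<subseteq> {..<?n} \<and> card S = d}"
  let ?f = "\<lambda>S. \<Prod>j\<in>S. (xs @ [x]) ! j"
  have fin: "finite S" if "S \<subseteq> {..<?n}" for S using that finite_subset by blast
  have split: "{S. S \<subseteq> {..<length (xs @ [x])} \<and> card S = Suc d} = ?A \<union> insert ?n ` ?C"
  proof (intro subset_antisym subsetI)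
    fix S assume S: "S \<in> {S. S \<subseteq> {..<length (xs @ [x])} \<and> card S = Suc d}"
    show "S \<in> ?A \<union> insert ?n ` ?C"
    proof (cases "?n \<in> S")
      case True
      have "S - {?n} \<subseteq> {..<?n}" using S by (auto simp: less_Suc_eq)
      moreover have "card (S - {?n}) = d" using S True by simp
      moreover have "S = insert ?n (S - {?n})" using True by auto
      ultimately show ?thesis by blast
    next
      case False
      then have "S \<subseteq> {..<?n}" using S by (auto simp: less_Suc_eq)
      then show ?thesis using S by auto
    qed
  next
    fix S assume "S \<in> ?A \<union> insert ?n ` ?C"
    then show "S \<in> {S. S \<subseteq> {..<length (xs @ [x])} \<and> card S = Suc d}"
    proof
      assume "S \<in> insert ?n ` ?C"
      then obtain T where T: "T \<subseteq> {..<?n}" "card T = d" "S = insert ?n T" by auto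
      then have "card S = Suc d" using fin[OF T(1)] by (subst T(3), subst card_insert_disjoint) auto
      then show ?thesis using T by (auto simp: less_Suc_eq)
    qed auto
  qed
  have inj: "inj_on (insert ?n) ?C"
  proof (rule inj_onI)
    fix S T assume "S \<in> ?C" "T \<in> ?C" and eq: "insert ?n S = insert ?n T"
    then have "?n \<notin> S" "?n \<notin> T" by auto
    with eq show "S = T" by (simp add: insert_ident)
  qed
  have "elem_sym (Suc d) (xs @ [x]) = sum ?f ?A + sum ?f (insert ?n ` ?C)"
    unfolding elem_sym_def split by (rule sum.union_disjoint) auto
  also have "sum ?f ?A = elem_sym (Suc d) xs"
    unfolding elem_sym_def by (intro sum.cong prod.cong refl) (auto simp: nth_append)
  also have "sum ?f (insert ?n ` ?C) = (\<Sum>S\<in>?C. ?f (insert ?n S))"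
    by (simp add: sum.reindex[OF inj])
  also have "\<dots> = (\<Sum>S\<in>?C. x * (\<Prod>j\<in>S. xs ! j))"
  proof (rule sum.cong[OF refl])
    fix S assume S: "S \<in> ?C"
    have "(\<Prod>j\<in>S. (xs @ [x]) ! j) = (\<Prod>j\<in>S. xs ! j)"
      using S by (intro prod.cong) (auto simp: nth_append)
    moreover have "?n \<notin> S" using S by auto
    ultimately show "?f (insert ?n S) = x * (\<Prod>j\<in>S. xs ! j)"
      using S fin by simp
  qed
  also have "\<dots> = x * elem_sym d xs"
    by (simp add: elem_sym_def sum_distrib_left)
  finally show ?thesis .
qed

section \<open>The alternating sum and its recurrence\<close>

text \<open>The right-hand side of the identity with an arbitrary list in place of the differences
  \<open>j * m - B ! j\<close>, so that its recurrence is purely algebraic.\<close>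

definition stirling_elem_sum :: "nat \<Rightarrow> int list \<Rightarrow> nat \<Rightarrow> int" where
  "stirling_elem_sum m xs k =
     (\<Sum>i=0..k. (- 1) ^ i * int m ^ (k - i) * int (Stirling (length xs - i) (length xs - k)) *
        elem_sym i xs)"

lemma stirling_elem_sum_0 [simp]: "stirling_elem_sum m xs 0 = 1"
  by (simp add: stirling_elem_sum_def)

text \<open>For \<open>k = length xs\<close> the truncated difference \<open>length xs - Suc k\<close> is 0 instead of negative, so that
  \<open>stirling_elem_sum m xs (Suc k)\<close> has to be replaced by 0.\<close>

lemma stirling_elem_sum_snoc:
  assumes "k \<le> length xs"
  shows "stirling_elem_sum m (xs @ [x]) (Suc k) =
    (if Suc k \<le> length xs then stirling_elem_sum m xs (Suc k) else 0) +
    (int (length xs - k) * int m - x) * stirling_elem_sum m xs k"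
proof -
  let ?n = "length xs"
  \<comment> \<open>\<open>g\<close> holds the coefficients for \<open>xs @ [x]\<close> at
    \<open>Suc k\<close>, \<open>h\<close> those for \<open>xs\<close> at \<open>k\<close>. An index
    shift turns \<open>g\<close> into \<open>- h\<close>, so the terms containing \<open>x\<close>
    sum to \<open>- x * stirling_elem_sum m xs k\<close>.\<close>
  define g where "g i = (- 1) ^ i * int m ^ (Suc k - i) * int (Stirling (Suc ?n - i) (?n - k))" for i
  define h where "h i = (- 1) ^ i * int m ^ (k - i) * int (Stirling (?n - i) (?n - k))" for i
  have gSuc: "g (Suc i) = - h i" for i
    by (simp add: g_def h_def)
  have "stirling_elem_sum m (xs @ [x]) (Suc k) = (\<Sum>i=0..Suc k. g i * elem_sym i (xs @ [x]))"
    by (simp add: stirling_elem_sum_def g_def)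
  also have "\<dots> = g 0 + (\<Sum>i=0..k. g (Suc i) * elem_sym (Suc i) (xs @ [x]))"
    by (subst sum.atLeast0_atMost_Suc_shift) simp
  also have "\<dots> = (g 0 + (\<Sum>i=0..k. g (Suc i) * elem_sym (Suc i) xs))
      + (\<Sum>i=0..k. g (Suc i) * (x * elem_sym i xs))"
    by (simp add: elem_sym_snoc distrib_left sum.distrib)
  also have "(\<Sum>i=0..k. g (Suc i) * (x * elem_sym i xs)) = - x * stirling_elem_sum m xs k"
    unfolding stirling_elem_sum_def h_def[symmetric]
    by (simp add: gSuc sum_distrib_left sum_negf mult_ac)
  also have "g 0 + (\<Sum>i=0..k. g (Suc i) * elem_sym (Suc i) xs) = (\<Sum>i=0..Suc k. g i * elem_sym i xs)"
    by (subst sum.atLeast0_atMost_Suc_shift) simp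
  also have "\<dots> = (if Suc k \<le> ?n then stirling_elem_sum m xs (Suc k) else 0)
      + int (?n - k) * int m * stirling_elem_sum m xs k"
  proof (cases "Suc k \<le> ?n")
    case False
    then have k: "k = ?n" using assms by simp
    \<comment> \<open>For \<open>i \<le> k\<close> the factor is a Stirling number of a positive
      number of elements into 0 blocks; for \<open>i = Suc k\<close> that number is 1, but the
      degree exceeds \<open>length xs\<close>.\<close>
    have "g i * elem_sym i xs = 0" if "i \<le> Suc k" for i
    proof (cases "i = Suc k")
      case True
      then show ?thesis using k by (simp add: elem_sym_eq_0)
    next
      case False
      then have "Suc ?n - i = Suc (?n - i)" using that k by simp
      then show ?thesis using k by (simp add: g_def)
    qed
    then have "(\<Sum>i=0..Suc k. g i * elem_sym i xs) = 0" by (intro sum.neutral) simp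
    then show ?thesis using False k by simp
  next
    case True
    \<comment> \<open>The Stirling recurrence gives the two summands. At \<open>i = Suc k\<close>
      the first one vanishes, as there are more blocks than elements; the cutoff also avoids the
      truncated exponent \<open>k - i\<close> there.\<close>
    have "g i = (- 1) ^ i * int m ^ (Suc k - i) * int (Stirling (?n - i) (?n - Suc k))
        + int (?n - k) * int m * (if i \<le> k then h i else 0)" if "i \<le> Suc k" for i
    proof -
      have "Stirling (Suc ?n - i) (?n - k) = Stirling (Suc (?n - i)) (Suc (?n - Suc k))"
        using True that by (simp add: Suc_diff_le Suc_diff_Suc)
      also have "\<dots> = (?n - k) * Stirling (?n - i) (?n - k) + Stirling (?n - i) (?n - Suc k)"
        unfolding Stirling.simps using True by (simp add: Suc_diff_Suc del: Stirling.simps)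
      finally have *: "g i = (- 1) ^ i * int m ^ (Suc k - i) *
        (int (?n - k) * int (Stirling (?n - i) (?n - k)) + int (Stirling (?n - i) (?n - Suc k)))"
        by (simp add: g_def)
      show ?thesis
      proof (cases "i \<le> k")
        case True
        then show ?thesis unfolding * h_def by (simp add: Suc_diff_le algebra_simps)
      next
        case False
        then have "i = Suc k" using that by simp
        then show ?thesis unfolding * using True by simp
      qed
    qed
    then have "(\<Sum>i=0..Suc k. g i * elem_sym i xs) =
      (\<Sum>i=0..Suc k. (- 1) ^ i * int m ^ (Suc k - i) * int (Stirling (?n - i) (?n - Suc k)) * elem_sym i xs
        + int (?n - k) * int m * ((if i \<le> k then h i else 0) * elem_sym i xs))"
      by (intro sum.cong refl) (simp add: algebra_simps)
    also have "\<dots> = stirling_elem_sum m xs (Suc k)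
        + int (?n - k) * int m * (\<Sum>i=0..Suc k. (if i \<le> k then h i else 0) * elem_sym i xs)"
      unfolding stirling_elem_sum_def sum.distrib sum_distrib_left ..
    also have "(\<Sum>i=0..Suc k. (if i \<le> k then h i else 0) * elem_sym i xs) = stirling_elem_sum m xs k"
      unfolding stirling_elem_sum_def by (simp add: h_def)
    finally show ?thesis using True by simp
  qed
  finally show ?thesis by (simp add: algebra_simps)
qed

section \<open>Rook placements after appending a column\<close>

lemma level_rows_iff:
  assumes "m \<ge> 1" "p \<ge> 1"
  shows "r \<in> level_rows m p \<longleftrightarrow> 1 \<le> r \<and> (r - 1) div m = p - 1"
proof -
  obtain q where p: "p = Suc q" using assms by (cases p) auto
  show ?thesis
  proof (cases r)
    case 0
    then show ?thesis by (simp add: level_rows_def)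
  next
    case (Suc s)
    have "s div m = q \<longleftrightarrow> q * m \<le> s \<and> s < Suc q * m"
      using assms less_eq_div_iff_mult_less_eq[of m q s] div_less_iff_less_mult[of m s "Suc q"]
      by (auto simp del: mult_Suc)
    then show ?thesis using Suc p by (auto simp: level_rows_def)
  qed
qed

text \<open>Replaces the existential over levels by an equality of quotients, from which symmetry
  and transitivity are immediate. Rows are counted from 1, hence the shift.\<close>

lemma same_level_iff:
  assumes "m \<ge> 1"
  shows "same_level m r s \<longleftrightarrow> 1 \<le> r \<and> 1 \<le> s \<and> (r - 1) div m = (s - 1) div m"
proof
  assume "same_level m r s"
  then show "1 \<le> r \<and> 1 \<le> s \<and> (r - 1) div m = (s - 1) div m"
    using assms by (auto simp: same_level_def level_rows_iff)
next
  assume "1 \<le> r \<and> 1 \<le> s \<and> (r - 1) div m = (s - 1) div m"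
  then show "same_level m r s"
    unfolding same_level_def using assms
    by (intro exI[of _ "Suc ((r - 1) div m)"]) (simp add: level_rows_iff)
qed

lemma terminates_in_levelI:
  assumes "q * m < h" "h \<le> Suc q * m"
  shows "terminates_in_level m h (Suc q)"
  unfolding terminates_in_level_def
proof (intro conjI allI impI)
  show "meets_level m h (Suc q)"
    using assms by (auto simp: meets_level_def level_rows_def intro!: exI[of _ h])
next
  fix p assume "meets_level m h p"
  then have "(p - 1) * m < h" by (auto simp: meets_level_def level_rows_def)
  then have "(p - 1) * m < Suc q * m" using assms by linarith
  then show "p \<le> Suc q" by (simp only: mult_less_cancel2) linarith
qed

section \<open>Singleton boards and the rows blocked in the last column\<close>

lemma singleton_board_snoc:
  assumes "singleton_board m (B @ [b])"
  shows "singleton_board m B"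
proof -
  have "card {j. j < length B \<and> terminates_in_level m (B ! j) p \<and> \<not> m dvd B ! j} \<le> 1"
    if "p \<ge> 1" for p
  proof -
    have "card {j. j < length B \<and> terminates_in_level m (B ! j) p \<and> \<not> m dvd B ! j} \<le>
      card {j. j < length (B @ [b]) \<and> terminates_in_level m ((B @ [b]) ! j) p \<and> \<not> m dvd (B @ [b]) ! j}"
      by (rule card_mono) (auto simp: nth_append)
    also have "\<dots> \<le> 1" using assms that by (simp add: singleton_board_def)
    finally show ?thesis .
  qed
  then show ?thesis
    using assms by (auto simp: singleton_board_def ferrers_board_def sorted_append)
qed

text \<open>Let \<open>Suc q\<close> be the level of \<open>c\<close>. If the last column ended
  below the top of this level, then \<open>q * m < B ! j \<le> b < Suc q * m\<close> for the column
  \<open>j\<close> of \<open>c\<close>, so both heights would lie strictly between consecutive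
  multiples of \<open>m\<close>.\<close>

lemma level_within_last_column:
  assumes m: "m \<ge> 1" and B: "singleton_board m (B @ [b])" and c: "c \<in> board_cells B"
  shows "Suc ((snd c - 1) div m) * m \<le> b"
proof (rule ccontr)
  define q where "q = (snd c - 1) div m"
  define j where "j = fst c"
  assume "\<not> Suc ((snd c - 1) div m) * m \<le> b"
  then have b: "b < Suc q * m" by (simp add: q_def)
  have j: "j < length B" "1 \<le> snd c" "snd c \<le> B ! j"
    using c by (auto simp: board_cells_def j_def)
  have "q * m \<le> snd c - 1" by (simp add: q_def)
  then have lo: "q * m < B ! j" using j by linarith
  have le: "B ! j \<le> b"
    using B j by (auto simp: singleton_board_def ferrers_board_def sorted_append)
  have ndvd: "\<not> m dvd h" if "q * m < h" "h < Suc q * m" for h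
  proof
    assume "m dvd h"
    then obtain t where "h = t * m" by (metis dvd_def mult.commute)
    then have "q < t" "t < Suc q" using that by (simp_all only: mult_less_cancel2)
    then show False by simp
  qed
  let ?X = "{i. i < length (B @ [b]) \<and> terminates_in_level m ((B @ [b]) ! i) (Suc q)
      \<and> \<not> m dvd (B @ [b]) ! i}"
  \<comment> \<open>Two distinct columns terminate in level \<open>Suc q\<close> with heights not
    divisible by \<open>m\<close>, against the singleton condition.\<close>
  have "{j, length B} \<subseteq> ?X"
    using j lo le b ndvd by (auto simp: nth_append intro!: terminates_in_levelI)
  then have "card {j, length B} \<le> card ?X" by (intro card_mono) auto
  moreover have "card ?X \<le> 1" using B unfolding singleton_board_def by simp
  ultimately show False using j by simp
qed

text \<open>The rows where a rook can be added to \<open>P\<close> in a new column of height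
  \<open>b\<close>. Only levels matter, since no rook of \<open>P\<close> stands in that
  column.\<close>

definition free_rows :: "nat \<Rightarrow> nat \<Rightarrow> (nat \<times> nat) set \<Rightarrow> nat set" where
  "free_rows m b P = {r \<in> {1..b}. \<forall>c\<in>P. \<not> same_level m (snd c) r}"

text \<open>Each rook blocks its whole level, which has \<open>m\<close> rows and lies inside the
  last column; distinct rooks occupy disjoint levels.\<close>

lemma card_free_rows:
  assumes m: "m \<ge> 1" and B: "singleton_board m (B @ [b])"
    and P: "P \<in> level_rook_placements m B k"
  shows "int (card (free_rows m b P)) = int b - int k * int m"
proof -
  define L where "L c = level_rows m (Suc ((snd c - 1) div m))" for c :: "nat \<times> nat"
  have P': "P \<subseteq> board_cells B" "finite P" "card P = k"
    "\<And>c d. c \<in> P \<Longrightarrow> d \<in> P \<Longrightarrow> c \<noteq> d \<Longrightarrow> \<not> same_level m (snd c) (snd d)"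
    using P by (auto simp: level_rook_placements_def)
  have pos: "1 \<le> snd c" if "c \<in> P" for c using that P'(1) by (auto simp: board_cells_def)
  have L: "r \<in> L c \<longleftrightarrow> same_level m (snd c) r" if "c \<in> P" for c r
    using pos[OF that] m by (auto simp: L_def level_rows_iff same_level_iff)
  have cardL: "card (L c) = m" for c by (simp add: L_def level_rows_def)
  have sub: "L c \<subseteq> {1..b}" if "c \<in> P" for c
    using level_within_last_column[OF m B, of c] that P'(1)
    by (auto simp: L_def level_rows_def)
  have disj: "L c \<inter> L d = {}" if "c \<in> P" "d \<in> P" "c \<noteq> d" for c d
    using P'(4)[OF that] L[OF that(1)] L[OF that(2)] m by (auto simp: same_level_iff)
  have "card (\<Union>c\<in>P. L c) = (\<Sum>c\<in>P. card (L c))"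
    using P'(2) disj by (intro card_UN_disjoint) (auto simp: L_def level_rows_def)
  then have cU: "card (\<Union>c\<in>P. L c) = k * m" by (simp add: cardL P'(3))
  have U: "(\<Union>c\<in>P. L c) \<subseteq> {1..b}" using sub by blast
  have "free_rows m b P = {1..b} - (\<Union>c\<in>P. L c)"
    using L by (auto simp: free_rows_def)
  then have "card (free_rows m b P) = b - k * m"
    using card_Diff_subset[OF finite_subset[OF U] U] cU by simp
  \<comment> \<open>The blocked rows all fit into the column, so the natural-number difference is
    not truncated and agrees with the integer one.\<close>
  moreover have "k * m \<le> b" using card_mono[OF _ U] cU by simp
  ultimately show ?thesis by simp
qed

section \<open>The recurrence of the rook numbers\<close>

lemma finite_board_cells: "finite (board_cells B)"
proof -
  have "board_cells B = (SIGMA j:{..<length B}. {1..B ! j})"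
    by (auto simp: board_cells_def)
  then show ?thesis by simp
qed

lemma finite_level_rook_placements: "finite (level_rook_placements m B k)"
  by (rule finite_subset[of _ "Pow (board_cells B)"])
    (auto simp: level_rook_placements_def finite_board_cells)

lemma board_cells_snoc:
  "board_cells (B @ [b]) = board_cells B \<union> Pair (length B) ` {1..b}"
  by (auto simp: board_cells_def nth_append less_Suc_eq)

text \<open>Placements are split by whether the last column holds a rook; deleting that rook leaves
  a placement of \<open>k\<close> rooks on \<open>B\<close>, for which its row is free.\<close>

lemma level_rook_placements_snoc:
  assumes m: "m \<ge> 1"
  shows "level_rook_placements m (B @ [b]) (Suc k) = level_rook_placements m B (Suc k) \<union>
    (\<lambda>(P, r). insert (length B, r) P) `
      (SIGMA P:level_rook_placements m B k. free_rows m b P)"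
    (is "?L = ?A \<union> ?f ` ?S")
proof (intro subset_antisym subsetI)
  fix Q assume Q: "Q \<in> ?L"
  have Q': "Q \<subseteq> board_cells (B @ [b])" "finite Q" "card Q = Suc k"
    "\<And>c d. c \<in> Q \<Longrightarrow> d \<in> Q \<Longrightarrow> c \<noteq> d \<Longrightarrow> fst c \<noteq> fst d \<and> \<not> same_level m (snd c) (snd d)"
    using Q by (auto simp: level_rook_placements_def)
  show "Q \<in> ?A \<union> ?f ` ?S"
  proof (cases "\<exists>r. (length B, r) \<in> Q")
    case False
    then have "Q \<subseteq> board_cells B" using Q'(1) by (auto simp: board_cells_snoc)
    then have "Q \<in> ?A" using Q' by (auto simp: level_rook_placements_def)
    then show ?thesis ..
  next
    case True
    then obtain r where r: "(length B, r) \<in> Q" ..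
    define P where "P = Q - {(length B, r)}"
    have QP: "Q = insert (length B, r) P" using r by (auto simp: P_def)
    \<comment> \<open>A second rook in the last column would share its column with
      \<open>(length B, r)\<close>.\<close>
    have "P \<subseteq> board_cells B"
      using Q'(1) Q'(4)[OF r] by (fastforce simp: board_cells_snoc P_def)
    moreover have "card P = k" using r Q' by (simp add: P_def)
    ultimately have P: "P \<in> level_rook_placements m B k"
      using Q' by (auto simp: level_rook_placements_def P_def)
    have "(length B, r) \<in> board_cells (B @ [b])" using r Q'(1) by blast
    then have "r \<in> {1..b}" by (auto simp: board_cells_def)
    moreover have "\<not> same_level m (snd c) r" if "c \<in> P" for c
      using Q'(4)[of c "(length B, r)"] r that by (auto simp: P_def)
    ultimately have "r \<in> free_rows m b P" by (auto simp: free_rows_def)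
    then have "(P, r) \<in> ?S" using P by blast
    then show ?thesis using QP by force
  qed
next
  fix Q assume "Q \<in> ?A \<union> ?f ` ?S"
  then show "Q \<in> ?L"
  proof
    assume "Q \<in> ?A"
    then show ?thesis by (auto simp: level_rook_placements_def board_cells_snoc)
  next
    assume "Q \<in> ?f ` ?S"
    then obtain P r where P: "P \<in> level_rook_placements m B k" and r: "r \<in> free_rows m b P"
      and Q: "Q = insert (length B, r) P" by auto
    have P': "P \<subseteq> board_cells B" "finite P" "card P = k"
      "\<And>c d. c \<in> P \<Longrightarrow> d \<in> P \<Longrightarrow> c \<noteq> d \<Longrightarrow> fst c \<noteq> fst d \<and> \<not> same_level m (snd c) (snd d)"
      using P by (auto simp: level_rook_placements_def)
    have col: "fst c < length B" if "c \<in> P" for c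
      using P'(1) that by (auto simp: board_cells_def)
    have "(length B, r) \<notin> P" using col by fastforce
    then have "card Q = Suc k" using P' Q by simp
    moreover have "Q \<subseteq> board_cells (B @ [b])"
      using P'(1) r Q by (auto simp: board_cells_snoc free_rows_def)
    moreover have "fst c \<noteq> fst d \<and> \<not> same_level m (snd c) (snd d)"
      if "c \<in> Q" "d \<in> Q" "c \<noteq> d" for c d
    proof -
      have new: "fst c \<noteq> length B \<and> \<not> same_level m (snd c) r \<and> \<not> same_level m r (snd c)"
        if "c \<in> P" for c
        using col[OF that] r that m by (auto simp: free_rows_def same_level_iff)
      show ?thesis using that new[of c] new[of d] P'(4)[of c d] Q by auto
    qed
    ultimately show ?thesis using P'(2) Q by (auto simp: level_rook_placements_def)
  qed
qed

text \<open>The union is disjoint and the insertion injective, because the rook in the last column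
  can be read off from the result. The number of free rows depends only on \<open>k\<close>, not on
  \<open>P\<close>, so the sum over \<open>P\<close> becomes a product.\<close>

lemma level_rook_number_snoc:
  assumes m: "m \<ge> 1" and B: "singleton_board m (B @ [b])"
  shows "int (level_rook_number (Suc k) m (B @ [b])) =
    int (level_rook_number (Suc k) m B) + (int b - int k * int m) * int (level_rook_number k m B)"
proof -
  let ?A = "level_rook_placements m B (Suc k)"
  let ?S = "SIGMA P:level_rook_placements m B k. free_rows m b P"
  let ?f = "\<lambda>(P, r). insert (length B, r) P"
  have no_last: "(length B, r) \<notin> P" if "P \<in> level_rook_placements m B i" for P r i
    using that by (auto simp: level_rook_placements_def board_cells_def)
  have finS: "finite ?S"
    by (intro finite_SigmaI finite_level_rook_placements) (simp add: free_rows_def)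
  have inj: "inj_on ?f ?S"
  proof (rule inj_onI, clarify)
    fix P r P' r'
    assume P: "P \<in> level_rook_placements m B k" "P' \<in> level_rook_placements m B k"
      and eq: "insert (length B, r) P = insert (length B, r') P'"
    have "r = r'" using eq no_last[OF P(2)] by blast
    then show "P = P' \<and> r = r'"
      using eq no_last[OF P(1)] no_last[OF P(2)] by (simp add: insert_ident)
  qed
  have disj: "?A \<inter> ?f ` ?S = {}" using no_last[of _ "Suc k"] by auto
  have "int (card ?S) = (\<Sum>P\<in>level_rook_placements m B k. int (card (free_rows m b P)))"
    by (subst card_SigmaI) (auto simp: finite_level_rook_placements free_rows_def)
  also have "\<dots> = (int b - int k * int m) * int (level_rook_number k m B)"
    by (simp add: card_free_rows[OF m B] level_rook_number_def)
  finally show ?thesis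
    using disj finS
    by (simp add: level_rook_number_def level_rook_placements_snoc[OF m] card_Un_disjoint
        finite_level_rook_placements card_image[OF inj])
qed

section \<open>Boundary values and induction over the columns\<close>

lemma level_rook_number_0 [simp]: "level_rook_number 0 m B = 1"
proof -
  have "level_rook_placements m B 0 = {{}}" by (auto simp: level_rook_placements_def)
  then show ?thesis by (simp add: level_rook_number_def)
qed

text \<open>The projection to columns is injective on a placement.\<close>

lemma level_rook_number_eq_0:
  assumes "length B < k"
  shows "level_rook_number k m B = 0"
proof -
  have "card P \<le> length B" if "P \<in> level_rook_placements m B k" for P
  proof -
    have "inj_on fst P" using that by (auto simp: level_rook_placements_def inj_on_def)
    moreover have "fst ` P \<subseteq> {..<length B}"
      using that by (auto simp: level_rook_placements_def board_cells_def)
    ultimately show ?thesis using card_inj_on_le[of fst P "{..<length B}"] by simp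
  qed
  then have "level_rook_placements m B k = {}"
    using assms by (fastforce simp: level_rook_placements_def)
  then show ?thesis by (simp add: level_rook_number_def)
qed

text \<open>Both sides are 1 for \<open>k = 0\<close> and obey the same recurrence when a column is
  appended. Allowing \<open>k = length B\<close> keeps the induction hypothesis available at
  \<open>k'\<close> when \<open>k\<close> is the full length of the longer board.\<close>

lemma level_rook_number_eq_stirling_elem_sum:
  assumes "m \<ge> 1" "singleton_board m B" "k \<le> length B"
  shows "int (level_rook_number k m B) =
    stirling_elem_sum m (map (\<lambda>j. int j * int m - int (B ! j)) [0..<length B]) k"
  using assms(2,3)
proof (induction B arbitrary: k rule: rev_induct)
  case Nil
  then show ?case by simp
next
  case (snoc b B)
  let ?xs = "map (\<lambda>j. int j * int m - int (B ! j)) [0..<length B]"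
  have B: "singleton_board m B" using snoc.prems singleton_board_snoc by blast
  have xs: "map (\<lambda>j. int j * int m - int ((B @ [b]) ! j)) [0..<length (B @ [b])]
      = ?xs @ [int (length B) * int m - int b]"
    by (simp add: nth_append)
  show ?case
  proof (cases k)
    case 0
    then show ?thesis by simp
  next
    case (Suc k')
    then have k': "k' \<le> length B" using snoc.prems by simp
    \<comment> \<open>More rooks than columns give no placement, which matches the 0 in the
      recurrence of the sum.\<close>
    have last: "int (level_rook_number (Suc k') m B) =
      (if Suc k' \<le> length B then stirling_elem_sum m ?xs (Suc k') else 0)"
      using snoc.IH[OF B] by (simp add: level_rook_number_eq_0)
    \<comment> \<open>With \<open>n = length B\<close> and the new entry
      \<open>x = n * m - b\<close>, the factor \<open>(n - k') * m - x\<close> equals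
      \<open>b - k' * m\<close>, the number of free rows.\<close>
    have "stirling_elem_sum m (?xs @ [int (length B) * int m - int b]) (Suc k') =
      (if Suc k' \<le> length B then stirling_elem_sum m ?xs (Suc k') else 0) +
      (int b - int k' * int m) * stirling_elem_sum m ?xs k'"
      using stirling_elem_sum_snoc[of k' ?xs m "int (length B) * int m - int b"] k'
      by (simp add: of_nat_diff algebra_simps)
    then show ?thesis
      unfolding Suc xs level_rook_number_snoc[OF assms(1) snoc.prems(1)] last
      using snoc.IH[OF B k'] by simp
  qed
qed

theorem theorem20:
  fixes m N k :: nat and B :: "nat list"
  assumes "m \<ge> 1"
    and "length B = N"
    and "singleton_board m B"
    and "fits_inside B (Delta_board N m)"
    and "k < N"
  shows "int (level_rook_number k m B) =
    (\<Sum>i=0..k. (- 1) ^ i * int m ^ (k - i) * int (Stirling (N - i) (N - k)) *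
       elem_sym i (map (\<lambda>j. int j * int m - int (B ! j)) [0..<N]))"
  using level_rook_number_eq_stirling_elem_sum[of m B k] assms
  by (simp add: stirling_elem_sum_def)

end
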